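(* Let $A_1,\dots,A_m\in\mathcal M_n(\mathbb C)$ be linearly independent and $V=(V_1,\dots,V_m)$ an $m$-tuple of complex $p\times q$ matrices. Then $$\sup_{\|\alpha\|=\|\beta\|=1}\|\rho_V(p^{(\alpha,\beta)}_{\mathbf A})\|\le\|\rho_V^{(n)}(P_{\mathbf A})\|,$$ where the supremum is over unit vectors $\alpha,\beta\in\mathbb C^n$.
   Context: All norms of matrices are operator norms with respect to Euclidean norms. $\mathbf A=(A_1,\dots,A_m)$, $\Omega_{\mathbf A}=\{z\in\mathbb C^m:\|z_1A_1+\cdots+z_mA_m\|_{\rm op}<1\}$, $P_{\mathbf A}(z)=z_1A_1+\cdots+z_mA_m$, and $p^{(\alpha,\beta)}_{\mathbf A}(z)=\langle P_{\mathbf A}(z)\alpha,\beta\rangle$. $\mathcal O(\Omega_{\mathbf A})$ is the algebra of functions holomorphic in a neighbourhood of $\overline{\Omega_{\mathbf A}}$. The homomorphism $\rho_V:\mathcal O(\Omega_{\mathbf A})\to\mathcal M_{p+q}(\mathbb C)$ (at the point $0$) is $$\rho_V(f)=\begin{pmatrix}f(0)I_p&\sum_{i=1}^m\partial_if(0)V_i\\0&f(0)I_q\end{pmatrix}.$$ For a matrix-valued function $F=(F_{ij})$ with entries in $\mathcal O(\Omega_{\mathbf A})$ and values in $\mathcal M_k(\mathbb C)$, $\rho_V^{(k)}(F)=(\rho_V(F_{ij}))_{i,j}$, the entrywise application of $\rho_V$. *)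

theory Defs
  imports "HOL-Analysis.Analysis"
begin

text \<open>Euclidean space of dimension \<open>n\<close> over the complex numbers is \<open>complex ^ 'n\<close> (whose library
  norm is the Euclidean one); a matrix with row index \<open>'r\<close> and column index \<open>'c\<close> has type
  \<open>complex ^ 'c ^ 'r\<close>.\<close>

definition opnorm :: "complex ^ 'c::finite ^ 'r::finite \<Rightarrow> real"
  where "opnorm M = onorm (\<lambda>x. M *v x)"

text \<open>The Hermitian inner product, linear in the first argument; the library's \<open>\<bullet>\<close> on
  \<open>complex ^ 'n\<close> is only its real part.\<close>

definition cinner :: "complex ^ 'n::finite \<Rightarrow> complex ^ 'n \<Rightarrow> complex"
  where "cinner u v = (\<Sum>i\<in>UNIV. u $ i * cnj (v $ i))"

text \<open>Multiplication of a matrix by a complex scalar; the library's \<open>*s\<close> on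
  \<open>complex ^ 'c ^ 'r\<close> takes its scalars in \<open>complex ^ 'c\<close>.\<close>

definition cscale :: "complex \<Rightarrow> complex ^ 'c::finite ^ 'r::finite \<Rightarrow> complex ^ 'c ^ 'r"
  where "cscale c M = (\<chi> i j. c * M $ i $ j)"

definition lin_indep :: "('m::finite \<Rightarrow> complex ^ 'c::finite ^ 'r::finite) \<Rightarrow> bool"
  where "lin_indep A \<longleftrightarrow>
    (\<forall>c. (\<Sum>k\<in>UNIV. cscale (c k) (A k)) = 0 \<longrightarrow> (\<forall>k. c k = 0))"

text \<open>In the usual notation, \<open>pencil A\<close> is \<open>P\<^sub>A\<close> and \<open>pencil_form A \<alpha> \<beta>\<close> is \<open>p\<^sub>A\<close> with superscript \<open>(\<alpha>, \<beta>)\<close>.\<close>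

definition pencil :: "('m::finite \<Rightarrow> complex ^ 'n::finite ^ 'n) \<Rightarrow> complex ^ 'm \<Rightarrow> complex ^ 'n ^ 'n"
  where "pencil A z = (\<Sum>k\<in>UNIV. cscale (z $ k) (A k))"

definition pencil_form :: "('m::finite \<Rightarrow> complex ^ 'n::finite ^ 'n) \<Rightarrow>
    complex ^ 'n \<Rightarrow> complex ^ 'n \<Rightarrow> complex ^ 'm \<Rightarrow> complex"
  where "pencil_form A \<alpha> \<beta> z = cinner (pencil A z *v \<alpha>) \<beta>"

definition Omega :: "('m::finite \<Rightarrow> complex ^ 'n::finite ^ 'n) \<Rightarrow> (complex ^ 'm) set"
  where "Omega A = {z. opnorm (pencil A z) < 1}"

text \<open>Functions holomorphic in a neighbourhood of the closure of \<open>D\<close>. Holomorphy in several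
  variables is Frechet differentiability with complex linear derivative.\<close>

definition hol_nbhd :: "(complex ^ 'm::finite) set \<Rightarrow> (complex ^ 'm \<Rightarrow> complex) set"
  where "hol_nbhd D = {f. \<exists>U. open U \<and> closure D \<subseteq> U \<and>
    (\<forall>z\<in>U. \<exists>L. (f has_derivative L) (at z) \<and> (\<forall>c v. L (c *s v) = c * L v))}"

definition partial :: "'m::finite \<Rightarrow> (complex ^ 'm \<Rightarrow> complex) \<Rightarrow> complex ^ 'm \<Rightarrow> complex"
  where "partial k f w = deriv (\<lambda>t. f (w + axis k t)) 0"

text \<open>The index type \<open>'p + 'q\<close> encodes the block decomposition; \<open>mat c\<close> is \<open>c\<close> times the
  identity matrix. The definition is total, but its intended domain is \<open>hol_nbhd (Omega A)\<close>.\<close>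

definition rho :: "('m::finite \<Rightarrow> complex ^ 'q::finite ^ 'p::finite) \<Rightarrow>
    (complex ^ 'm \<Rightarrow> complex) \<Rightarrow> complex ^ ('p + 'q) ^ ('p + 'q)"
  where "rho V f = (\<chi> r s. case r of
      Inl a \<Rightarrow> (case s of
          Inl b \<Rightarrow> (mat (f 0) :: complex ^ 'p ^ 'p) $ a $ b
        | Inr b \<Rightarrow> (\<Sum>k\<in>UNIV. cscale (partial k f 0) (V k)) $ a $ b)
    | Inr a \<Rightarrow> (case s of
          Inl b \<Rightarrow> 0
        | Inr b \<Rightarrow> (mat (f 0) :: complex ^ 'q ^ 'q) $ a $ b))"

text \<open>A \<open>k \<times> k\<close> matrix of \<open>(p + q) \<times> (p + q)\<close> matrices is read as one matrix with rows and columns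
  indexed by pairs (outer index, inner index).\<close>

definition rho_amp :: "('m::finite \<Rightarrow> complex ^ 'q::finite ^ 'p::finite) \<Rightarrow>
    (complex ^ 'm \<Rightarrow> complex ^ 'k::finite ^ 'k) \<Rightarrow>
    complex ^ ('k \<times> ('p + 'q)) ^ ('k \<times> ('p + 'q))"
  where "rho_amp V F = (\<chi> r s. rho V (\<lambda>z. F z $ fst r $ fst s) $ snd r $ snd s)"

lemma clinear_in_hol_nbhd:
  fixes f :: "complex ^ 'm::finite \<Rightarrow> complex"
  assumes add: "\<And>x y. f (x + y) = f x + f y" and scale: "\<And>c v. f (c *s v) = c * f v"
  shows "f \<in> hol_nbhd D"
proof -
  have *: "r *\<^sub>R v = complex_of_real r *s v" for r and v :: "complex ^ 'm"
    unfolding vec_eq_iff vector_scaleR_component vector_smult_component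
    by (simp add: scaleR_conv_of_real)
  have "linear f"
    by (rule linearI) (simp_all add: add * scale scaleR_conv_of_real del: vector_scaleR_component)
  then have "(f has_derivative f) (at z)" for z
    by (simp add: linear_linear bounded_linear_imp_has_derivative)
  then show ?thesis
    unfolding hol_nbhd_def using scale by (intro CollectI exI[of _ UNIV]) auto
qed

lemma pencil_entry: "pencil A z $ i $ j = (\<Sum>k\<in>UNIV. z $ k * A k $ i $ j)"
  by (simp add: pencil_def cscale_def)

lemma pencil_entry_in_hol_nbhd: "(\<lambda>z. pencil A z $ i $ j) \<in> hol_nbhd (Omega A)"
  by (intro clinear_in_hol_nbhd)
    (simp_all add: pencil_entry algebra_simps sum.distrib sum_distrib_left)

lemma pencil_form_in_hol_nbhd: "pencil_form A \<alpha> \<beta> \<in> hol_nbhd (Omega A)"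
  by (intro clinear_in_hol_nbhd)
    (simp_all add: pencil_form_def cinner_def matrix_vector_mult_def pencil_entry algebra_simps
      sum.distrib sum_distrib_left sum_distrib_right)

end

theory Submission
  imports Defs
begin

text \<open>Since \<open>P\<^sub>A\<close> is linear, \<open>\<rho>\<^sub>V\<close> of \<open>p\<^sub>A\<close> with superscript \<open>(\<alpha>, \<beta>)\<close> is the compression
  \<open>(\<beta>\<^sup>* \<otimes> I) R (\<alpha> \<otimes> I)\<close> of \<open>R\<close>, the amplification of \<open>\<rho>\<^sub>V\<close> applied to \<open>P\<^sub>A\<close>; for unit vectors
  \<open>\<alpha>\<close> and \<open>\<beta>\<close> the outer factors are contractions.\<close>

text \<open>The elementary tensor u \<otimes> x in the pair indexing of \<open>rho_amp\<close>, so
  that \<open>vec_tensor \<alpha>\<close> is the factor \<alpha> \<otimes> I.\<close>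

definition vec_tensor :: "complex ^ 'k::finite \<Rightarrow> complex ^ 'r::finite \<Rightarrow> complex ^ ('k \<times> 'r)"
  where "vec_tensor u x = (\<chi> s. u $ fst s * x $ snd s)"

text \<open>The adjoint of \<open>vec_tensor v\<close>; v is conjugated because it stands in the
  second slot of \<open>cinner\<close>.\<close>

definition vec_contract :: "complex ^ 'k::finite \<Rightarrow> complex ^ ('k \<times> 'r::finite) \<Rightarrow> complex ^ 'r"
  where "vec_contract v w = (\<chi> r. \<Sum>i\<in>UNIV. cnj (v $ i) * w $ (i, r))"

lemma norm_vec_sq: "(norm (x :: complex ^ 'n::finite))\<^sup>2 = (\<Sum>i\<in>UNIV. (norm (x $ i))\<^sup>2)"
  by (simp add: norm_vec_def L2_set_def sum_nonneg)

lemma norm_vec_tensor: "norm (vec_tensor u x) = norm u * norm x"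
proof -
  have "(norm (vec_tensor u x))\<^sup>2 = (norm u * norm x)\<^sup>2"
    by (simp add: norm_vec_sq vec_tensor_def norm_mult power_mult_distrib sum_product
        sum.cartesian_product case_prod_beta flip: UNIV_Times_UNIV)
  then show ?thesis by simp
qed

text \<open>Cauchy-Schwarz in the outer index for each fixed inner index r, followed by summing the
  squares over r.\<close>

lemma norm_vec_contract_le: "norm (vec_contract v w) \<le> norm v * norm w"
proof (rule power2_le_imp_le)
  have "norm (vec_contract v w $ r) \<le> norm v * L2_set (\<lambda>i. norm (w $ (i, r))) UNIV" for r
  proof -
    have "norm (vec_contract v w $ r) \<le> (\<Sum>i\<in>UNIV. \<bar>norm (v $ i)\<bar> * \<bar>norm (w $ (i, r))\<bar>)"
      unfolding vec_contract_def by (simp add: sum_norm_le norm_mult)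
    also have "\<dots> \<le> norm v * L2_set (\<lambda>i. norm (w $ (i, r))) UNIV"
      unfolding norm_vec_def by (rule L2_set_mult_ineq)
    finally show ?thesis .
  qed
  then have "(norm (vec_contract v w $ r))\<^sup>2 \<le> (norm v)\<^sup>2 * (\<Sum>i\<in>UNIV. (norm (w $ (i, r)))\<^sup>2)" for r
    using power_mono[of "norm (vec_contract v w $ r)" _ 2]
    by (fastforce simp: power_mult_distrib L2_set_def sum_nonneg)
  then have "(norm (vec_contract v w))\<^sup>2
      \<le> (\<Sum>r\<in>UNIV. (norm v)\<^sup>2 * (\<Sum>i\<in>UNIV. (norm (w $ (i, r)))\<^sup>2))"
    unfolding norm_vec_sq[of "vec_contract v w"] by (intro sum_mono)
  also have "\<dots> = (norm v)\<^sup>2 * (\<Sum>i\<in>UNIV. \<Sum>r\<in>UNIV. (norm (w $ (i, r)))\<^sup>2)"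
    by (subst sum.swap) (simp add: sum_distrib_left)
  also have "\<dots> = (norm v * norm w)\<^sup>2"
    by (simp add: norm_vec_sq[of w] power_mult_distrib sum.cartesian_product flip: UNIV_Times_UNIV)
  finally show "(norm (vec_contract v w))\<^sup>2 \<le> (norm v * norm w)\<^sup>2" .
qed simp

lemma norm_mult_vec_le_opnorm:
  fixes M :: "complex ^ 'c::finite ^ 'r::finite"
  shows "norm (M *v x) \<le> opnorm M * norm x"
proof -
  \<comment> \<open>\<open>onorm\<close> is a real supremum and bounds its quotients only for a
    bounded map; finite dimension turns linearity into boundedness.\<close>
  have "linear (\<lambda>x. M *v x)"
    by (rule linearI)
      (simp_all add: vec_eq_iff matrix_vector_mult_def algebra_simps sum.distrib scaleR_sum_right)
  then show ?thesis
    unfolding opnorm_def by (intro onorm) (rule linear_conv_bounded_linear[THEN iffD1])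
qed

lemma opnorm_le:
  assumes "\<And>x. norm (M *v x) \<le> b * norm x"
  shows "opnorm M \<le> b"
  unfolding opnorm_def using assms by (rule onorm_le)

text \<open>At the base point 0 the partial derivative sees only the restriction of f to the k-th
  axis, here a linear function of t.\<close>

lemma partial_at_0:
  assumes "\<And>t. f (axis k t) = t * c"
  shows "partial k f 0 = c"
proof -
  have "((\<lambda>t. t * c) has_field_derivative c) (at 0)"
    by (auto intro!: derivative_eq_intros)
  then show ?thesis
    unfolding partial_def using assms by (simp add: DERIV_imp_deriv)
qed

lemma pencil_axis_entry: "pencil A (axis k t) $ i $ j = t * A k $ i $ j"
proof -
  have "pencil A (axis k t) $ i $ j = (\<Sum>l\<in>UNIV. if l = k then t * A l $ i $ j else 0)"
    unfolding pencil_entry by (rule sum.cong) (auto simp: axis_def)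
  then show ?thesis by simp
qed

lemma pencil_form_eq:
  "pencil_form A \<alpha> \<beta> z = (\<Sum>i\<in>UNIV. \<Sum>j\<in>UNIV. cnj (\<beta> $ i) * \<alpha> $ j * pencil A z $ i $ j)"
  by (simp add: pencil_form_def cinner_def matrix_vector_mult_def sum_distrib_left
      sum_distrib_right mult_ac)

text \<open>\<open>rho V f\<close> depends on f only through its value and partial derivatives at 0,
  so the sum in \<open>pencil_form_eq\<close> passes through it.\<close>

lemma rho_pencil_form_entry:
  "rho V (pencil_form A \<alpha> \<beta>) $ r $ s
    = (\<Sum>i\<in>UNIV. \<Sum>j\<in>UNIV. cnj (\<beta> $ i) * \<alpha> $ j * rho V (\<lambda>z. pencil A z $ i $ j) $ r $ s)"
proof -
  have entry: "partial k (\<lambda>z. pencil A z $ i $ j) 0 = A k $ i $ j" for k i j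
    by (rule partial_at_0) (rule pencil_axis_entry)
  have form: "partial k (pencil_form A \<alpha> \<beta>) 0
      = (\<Sum>i\<in>UNIV. \<Sum>j\<in>UNIV. cnj (\<beta> $ i) * \<alpha> $ j * A k $ i $ j)" for k
    by (rule partial_at_0) (simp add: pencil_form_eq pencil_axis_entry sum_distrib_left mult_ac)
  \<comment> \<open>The diagonal blocks vanish, which leaves the upper right block;
    \<open>swap\<close> settles that one.\<close>
  have zero: "pencil_form A \<alpha> \<beta> 0 = 0" "pencil A 0 $ i $ j = 0" for i j
    by (simp_all add: pencil_form_eq pencil_entry)
  have swap: "(\<Sum>k\<in>UNIV. (\<Sum>i\<in>UNIV. \<Sum>j\<in>UNIV. cnj (\<beta> $ i) * \<alpha> $ j * A k $ i $ j) * V k $ a $ b)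
      = (\<Sum>i\<in>UNIV. \<Sum>j\<in>UNIV. cnj (\<beta> $ i) * \<alpha> $ j * (\<Sum>k\<in>UNIV. A k $ i $ j * V k $ a $ b))" for a b
    unfolding sum_distrib_left sum_distrib_right
    by (subst sum.swap, rule sum.cong[OF refl], subst sum.swap) (simp add: mult_ac)
  show ?thesis
    by (cases r; cases s) (simp_all add: rho_def zero entry form cscale_def mat_def swap)
qed

lemma rho_pencil_form_mult_vec:
  "rho V (pencil_form A \<alpha> \<beta>) *v x = vec_contract \<beta> (rho_amp V (pencil A) *v vec_tensor \<alpha> x)"
proof -
  have "(rho V (pencil_form A \<alpha> \<beta>) *v x) $ r
      = vec_contract \<beta> (rho_amp V (pencil A) *v vec_tensor \<alpha> x) $ r" for r
  proof -
    let ?R = "\<lambda>i j s. rho V (\<lambda>z. pencil A z $ i $ j) $ r $ s"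
    have "(rho V (pencil_form A \<alpha> \<beta>) *v x) $ r
        = (\<Sum>s\<in>UNIV. \<Sum>i\<in>UNIV. \<Sum>j\<in>UNIV. cnj (\<beta> $ i) * (?R i j s * (\<alpha> $ j * x $ s)))"
      by (simp add: matrix_vector_mult_def rho_pencil_form_entry sum_distrib_right mult.assoc
          mult.left_commute[of "\<alpha> $ _"])
    \<comment> \<open>With s innermost, j and s together form the column index of
      \<open>rho_amp\<close>, and i is left for the contraction.\<close>
    also have "\<dots> = (\<Sum>i\<in>UNIV. \<Sum>j\<in>UNIV. \<Sum>s\<in>UNIV. cnj (\<beta> $ i) * (?R i j s * (\<alpha> $ j * x $ s)))"
      by (subst sum.swap, rule sum.cong[OF refl], rule sum.swap)
    also have "\<dots> = vec_contract \<beta> (rho_amp V (pencil A) *v vec_tensor \<alpha> x) $ r"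
      by (simp add: vec_contract_def matrix_vector_mult_def rho_amp_def vec_tensor_def
          sum_distrib_left sum.cartesian_product case_prod_beta flip: UNIV_Times_UNIV)
    finally show ?thesis .
  qed
  then show ?thesis by (simp add: vec_eq_iff)
qed

theorem lemma1p1:
  fixes A :: "'m::finite \<Rightarrow> complex ^ 'n::finite ^ 'n"
    and V :: "'m \<Rightarrow> complex ^ 'q::finite ^ 'p::finite"
  assumes "lin_indep A"
  shows "(SUP (\<alpha>, \<beta>) \<in> {(\<alpha>, \<beta>). norm \<alpha> = 1 \<and> norm \<beta> = 1}. ereal (opnorm (rho V (pencil_form A \<alpha> \<beta>))))
    \<le> ereal (opnorm (rho_amp V (pencil A)))"
proof -
  have "opnorm (rho V (pencil_form A \<alpha> \<beta>)) \<le> opnorm (rho_amp V (pencil A))"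
    if "norm \<alpha> = 1" "norm \<beta> = 1" for \<alpha> \<beta> :: "complex ^ 'n"
  proof (rule opnorm_le)
    fix x
    have "norm (rho V (pencil_form A \<alpha> \<beta>) *v x) \<le> norm (rho_amp V (pencil A) *v vec_tensor \<alpha> x)"
      unfolding rho_pencil_form_mult_vec using norm_vec_contract_le[of \<beta>] that by simp
    also have "\<dots> \<le> opnorm (rho_amp V (pencil A)) * norm x"
      using norm_mult_vec_le_opnorm[of _ "vec_tensor \<alpha> x"] that by (simp add: norm_vec_tensor)
    finally show "norm (rho V (pencil_form A \<alpha> \<beta>) *v x) \<le> opnorm (rho_amp V (pencil A)) * norm x" .
  qed
  \<comment> \<open>In the complete lattice \<open>ereal\<close> a uniform upper bound suffices,
    with no side condition on the family.\<close>
  then show ?thesis by (auto intro!: SUP_least)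
qed

end
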